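(* Let $n\ge 2$ be an integer and let $C$ be a beautiful $n$-edge-colouring of the complete graph $K_{n+1}$. Then $K_{n+1}$ contains at least $2^{\lfloor\frac{n-1}{2}\rfloor}$ different heterochromatic spanning trees.
   Context: An $n$-edge-colouring of $K_{n+1}$ is a partition of $E(K_{n+1})$ into $n$ colour classes; it is nice if the class sizes are $1,2,\ldots,n$, and we then index the classes $C_1,\ldots,C_n$ with $|C_i|=i$. Let $G_i$ be the subgraph of $K_{n+1}$ formed by the edges of $C_i$ and the vertices incident to them. A nice colouring is called beautiful if every $G_i$ is acyclic and there is a partition $\{V_1,V_2\}$ of $V(K_{n+1})$ with $|V_2|=\lceil\frac{n+1}{2}\rceil$ and $|V_1|=\lfloor\frac{n+1}{2}\rfloor$ such that: (i) the subgraph of $K_{n+1}$ formed by the union of all classes $C_i$ with $i\equiv n \pmod 2$ is the complete bipartite graph with parts $V_1,V_2$; (ii) for every $i\equiv n\pmod 2$, $|V(G_i)\cap V_1|=\lfloor\frac{|V(G_i)|}{2}\rfloor$ and $|V(G_i)\cap V_2|=\lceil\frac{|V(G_i)|}{2}\rceil$; (iii) for every $i\not\equiv n\pmod 2$, $|C_i\cap E(K_{n+1}[V_1])|=\lfloor\frac{i}{2}\rfloor$ and $|C_i\cap E(K_{n+1}[V_2])|=\lceil\frac{i}{2}\rceil$, where $K_{n+1}[V_j]$ is the complete subgraph induced by $V_j$. A subgraph is heterochromatic if all its edges have different colours. *)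

theory Defs
  imports "HOL-Library.Ramsey" "HOL-Library.Disjoint_Sets"
begin

text \<open>
  Undirected simple graphs are given by a vertex set and a set of edges, an edge being a
  two-element set of vertices. The complete graph on \<open>V\<close> has the edge set \<open>nsets V 2\<close>.
  The subgraph formed by a set \<open>E\<close> of edges and the vertices incident to them has the vertex
  set \<open>\<Union>E\<close>.
\<close>

definition walk :: "'a set set \<Rightarrow> 'a list \<Rightarrow> bool" where
  "walk E p \<longleftrightarrow> p \<noteq> [] \<and> successively (\<lambda>u v. {u, v} \<in> E) p"

text \<open>
  A cycle is listed without repeating its first vertex at the end. The bound on the length
  excludes going back and forth along a single edge.
\<close>

definition cycle :: "'a set set \<Rightarrow> 'a list \<Rightarrow> bool" where
  "cycle E p \<longleftrightarrow> 3 \<le> length p \<and> distinct p \<and> walk E p \<and> {last p, hd p} \<in> E"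

definition acyclic_graph :: "'a set set \<Rightarrow> bool" where
  "acyclic_graph E \<longleftrightarrow> (\<nexists>p. cycle E p)"

definition connected_graph :: "'a set \<Rightarrow> 'a set set \<Rightarrow> bool" where
  "connected_graph V E \<longleftrightarrow>
     V \<noteq> {} \<and> (\<forall>u\<in>V. \<forall>v\<in>V. \<exists>p. walk E p \<and> hd p = u \<and> last p = v)"

text \<open>A spanning tree of the complete graph on \<open>V\<close> is identified with its edge set.\<close>

definition spanning_tree :: "'a set \<Rightarrow> 'a set set \<Rightarrow> bool" where
  "spanning_tree V T \<longleftrightarrow> T \<subseteq> nsets V 2 \<and> connected_graph V T \<and> acyclic_graph T"

text \<open>
  Colourings are families \<open>C\<close> whose members with index in \<open>{1..n}\<close> are the colour classes;
  the values of \<open>C\<close> elsewhere are irrelevant.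
\<close>

definition edge_colouring :: "nat \<Rightarrow> 'a set \<Rightarrow> (nat \<Rightarrow> 'a set set) \<Rightarrow> bool" where
  "edge_colouring n V C \<longleftrightarrow> inj_on C {1..n} \<and> partition_on (nsets V 2) (C ` {1..n})"

definition nice_colouring :: "nat \<Rightarrow> 'a set \<Rightarrow> (nat \<Rightarrow> 'a set set) \<Rightarrow> bool" where
  "nice_colouring n V C \<longleftrightarrow> edge_colouring n V C \<and> (\<forall>i\<in>{1..n}. card (C i) = i)"

text \<open>
  On natural numbers, \<open>k div 2\<close> and \<open>(k + 1) div 2\<close> are the floor and the ceiling of \<open>k/2\<close>.
  Equality of the subgraph formed by a union of classes with a complete bipartite graph is stated
  for the edge sets: for \<open>n \<ge> 1\<close> both parts are nonempty, so every vertex is incident to an edge.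
\<close>

definition beautiful_colouring :: "nat \<Rightarrow> 'a set \<Rightarrow> (nat \<Rightarrow> 'a set set) \<Rightarrow> bool" where
  "beautiful_colouring n V C \<longleftrightarrow>
     nice_colouring n V C \<and>
     (\<forall>i\<in>{1..n}. acyclic_graph (C i)) \<and>
     (\<exists>V1 V2.
        V1 \<union> V2 = V \<and> V1 \<inter> V2 = {} \<and>
        card V1 = (n + 1) div 2 \<and> card V2 = (n + 1 + 1) div 2 \<and>
        (\<Union>i\<in>{i \<in> {1..n}. i mod 2 = n mod 2}. C i) = {{u, v} | u v. u \<in> V1 \<and> v \<in> V2} \<and>
        (\<forall>i\<in>{1..n}. i mod 2 = n mod 2 \<longrightarrow>
           card (\<Union>(C i) \<inter> V1) = card (\<Union>(C i)) div 2 \<and>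
           card (\<Union>(C i) \<inter> V2) = (card (\<Union>(C i)) + 1) div 2) \<and>
        (\<forall>i\<in>{1..n}. i mod 2 \<noteq> n mod 2 \<longrightarrow>
           card (C i \<inter> nsets V1 2) = i div 2 \<and>
           card (C i \<inter> nsets V2 2) = (i + 1) div 2))"

definition heterochromatic :: "nat \<Rightarrow> (nat \<Rightarrow> 'a set set) \<Rightarrow> 'a set set \<Rightarrow> bool" where
  "heterochromatic n C T \<longleftrightarrow>
     (\<forall>i\<in>{1..n}. \<forall>e\<in>T. \<forall>f\<in>T. e \<in> C i \<and> f \<in> C i \<longrightarrow> e = f)"

end

theory Submission
  imports Defs
begin

text \<open>
  The classes \<open>C i\<close> with \<open>2 \<le> i < n\<close> and \<open>i\<close> not congruent to \<open>n\<close> modulo 2 number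
  \<open>(n - 1) div 2\<close>, and each has edges inside both \<open>V1\<close> and \<open>V2\<close>. For every choice of a side
  for each of them there is a heterochromatic spanning tree whose edges of these colours lie on
  the chosen sides, and distinct choices give distinct trees. Such a tree is an independent
  transversal, in the graphic matroid, of the classes restricted to the chosen sides, so it
  suffices to verify Rado's condition. For a set of colours let \<open>a\<close> be its largest colour
  congruent to \<open>n\<close> and \<open>p\<close> its largest other one. If \<open>p < a\<close>, then \<open>C a\<close> alone has large enough
  rank. Otherwise the chosen side of \<open>C p\<close> is a forest, and each vertex of \<open>C a\<close> on the opposite
  side adds one to the rank; there are about \<open>a / 2\<close> of these because the acyclic \<open>C a\<close> has more
  than \<open>a\<close> vertices, split evenly between \<open>V1\<close> and \<open>V2\<close>.
\<close>

section \<open>Connectivity and the rank function of the graphic matroid\<close>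

definition conn :: "'a set set \<Rightarrow> ('a \<times> 'a) set" where
  "conn E = {(u, v). {u, v} \<in> E}\<^sup>*"

text \<open>\<open>conn E\<close> lives on the whole type, where vertices without edges form
  singleton classes; \<open>V\<close> only selects the classes to be counted.\<close>

definition components :: "'a set \<Rightarrow> 'a set set \<Rightarrow> 'a set set" where
  "components V E = (\<lambda>u. conn E `` {u}) ` V"

text \<open>The rank function of the graphic matroid of the complete graph on \<open>V\<close>: the
  size of a spanning forest of \<open>E\<close>.\<close>

definition graph_rank :: "'a set \<Rightarrow> 'a set set \<Rightarrow> nat" where
  "graph_rank V E = card V - card (components V E)"

lemma conn_refl [simp]: "(u, u) \<in> conn E"
  by (simp add: conn_def)

lemma conn_edge: "{u, v} \<in> E \<Longrightarrow> (u, v) \<in> conn E"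
  by (auto simp: conn_def)

lemma conn_trans: "(u, v) \<in> conn E \<Longrightarrow> (v, w) \<in> conn E \<Longrightarrow> (u, w) \<in> conn E"
  unfolding conn_def by (rule rtrancl_trans)

lemma sym_conn: "sym (conn E)"
  unfolding conn_def by (rule sym_rtrancl) (auto simp: sym_def insert_commute)

lemma conn_commute: "(u, v) \<in> conn E \<longleftrightarrow> (v, u) \<in> conn E"
  using sym_conn by (metis symD)

lemma conn_mono: "E \<subseteq> F \<Longrightarrow> conn E \<subseteq> conn F"
  unfolding conn_def by (rule rtrancl_mono) auto

lemma conn_class_eq_iff: "conn E `` {u} = conn E `` {v} \<longleftrightarrow> (u, v) \<in> conn E"
  using conn_trans conn_commute by (metis (no_types, lifting) Image_singleton_iff conn_refl subset_antisym subsetI)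

lemma conn_eq_if_not_incident:
  assumes "(u, v) \<in> conn E" "u \<notin> \<Union>E"
  shows "v = u"
  using assms unfolding conn_def by (metis (mono_tags, lifting) UnionI case_prodD converse_rtranclE insertI1 mem_Collect_eq)

text \<open>A walk through the new edge can be shortened to one that uses it at most once, in one of
  its two directions.\<close>

lemma conn_insert:
  "conn (insert {a, b} E) = conn E
     \<union> {(x, y). (x, a) \<in> conn E \<and> (b, y) \<in> conn E}
     \<union> {(x, y). (x, b) \<in> conn E \<and> (a, y) \<in> conn E}" (is "?L = ?R")
proof
  show "?L \<subseteq> ?R"
  proof (rule subrelI)
    fix x y assume "(x, y) \<in> ?L"
    then show "(x, y) \<in> ?R" unfolding conn_def[of "insert _ _"]
    proof (induction rule: rtrancl_induct)
      case (step y z)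
      then consider "{y, z} \<in> E" | "y = a" "z = b" | "y = b" "z = a"
        by (auto simp: doubleton_eq_iff)
      then show ?case
        using step.IH by cases (auto dest: conn_edge intro: conn_trans)
    qed simp
  qed
  have E: "conn E \<subseteq> ?L" by (rule conn_mono) auto
  have ab: "(a, b) \<in> ?L" by (rule conn_edge) simp
  then have ba: "(b, a) \<in> ?L" by (simp add: conn_commute)
  show "?R \<subseteq> ?L"
    using E ab ba by (auto intro: conn_trans dest!: subsetD[OF E])
qed

lemma components_insert_connected:
  assumes "(a, b) \<in> conn E"
  shows "components V (insert {a, b} E) = components V E"
proof -
  have "conn (insert {a, b} E) = conn E"
    using assms conn_commute[of a b E] unfolding conn_insert by (auto intro: conn_trans)
  then show ?thesis by (simp add: components_def)
qed

lemma finite_components [simp]: "finite V \<Longrightarrow> finite (components V E)"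
  by (simp add: components_def)

lemma card_components_le: "finite V \<Longrightarrow> card (components V E) \<le> card V"
  by (simp add: components_def card_image_le)

text \<open>The classes of \<open>a\<close> and \<open>b\<close> merge and all others stay as they
  are.\<close>

lemma card_components_insert:
  assumes "finite V" "a \<in> V" "b \<in> V" "(a, b) \<notin> conn E"
  shows "Suc (card (components V (insert {a, b} E))) = card (components V E)"
proof -
  let ?cl = "\<lambda>x. conn E `` {x}"
  let ?D = "components V E - {?cl a, ?cl b}"
  have new: "conn (insert {a, b} E) `` {x} =
      (if (x, a) \<in> conn E \<or> (x, b) \<in> conn E then ?cl a \<union> ?cl b else ?cl x)" for x
    unfolding conn_insert by (auto intro: conn_trans simp: conn_commute)
  have "components V (insert {a, b} E) = insert (?cl a \<union> ?cl b) ?D"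
  proof (intro equalityI subsetI)
    fix X assume "X \<in> components V (insert {a, b} E)"
    then obtain x where x: "x \<in> V" "X = conn (insert {a, b} E) `` {x}"
      by (auto simp: components_def)
    show "X \<in> insert (?cl a \<union> ?cl b) ?D"
    proof (cases "(x, a) \<in> conn E \<or> (x, b) \<in> conn E")
      case True then show ?thesis using x new by simp
    next
      case False
      then have "X = ?cl x" using x new by simp
      moreover have "?cl x \<noteq> ?cl a" "?cl x \<noteq> ?cl b"
        using False unfolding conn_class_eq_iff by auto
      ultimately show ?thesis using x(1) by (simp add: components_def)
    qed
  next
    fix X assume X: "X \<in> insert (?cl a \<union> ?cl b) ?D"
    show "X \<in> components V (insert {a, b} E)"
    proof (cases "X = ?cl a \<union> ?cl b")
      case True
      then have "X = conn (insert {a, b} E) `` {a}" using new by simp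
      then show ?thesis using assms by (auto simp: components_def)
    next
      case False
      then obtain x where x: "x \<in> V" "X = ?cl x" "?cl x \<noteq> ?cl a" "?cl x \<noteq> ?cl b"
        using X by (auto simp: components_def)
      then have "X = conn (insert {a, b} E) `` {x}"
        using new[of x] unfolding conn_class_eq_iff by simp
      then show ?thesis using x by (auto simp: components_def)
    qed
  qed
  moreover have "?cl a \<union> ?cl b \<notin> ?D"
  proof
    assume "?cl a \<union> ?cl b \<in> ?D"
    then obtain x where x: "?cl x = ?cl a \<union> ?cl b" "?cl x \<noteq> ?cl a"
      by (auto simp: components_def)
    then have "(x, a) \<in> conn E" by (metis Image_singleton_iff UnI1 conn_refl)
    then show False using x(2) unfolding conn_class_eq_iff by simp
  qed
  moreover have "?cl a \<noteq> ?cl b"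
    using assms(4) unfolding conn_class_eq_iff .
  moreover have "?cl a \<in> components V E" "?cl b \<in> components V E"
    using assms by (auto simp: components_def)
  moreover have "card (components V E) \<ge> card {?cl a, ?cl b}"
    using calculation assms(1) by (intro card_mono) auto
  ultimately show ?thesis
    using assms(1) by (simp add: card_Diff_subset)
qed

lemma graph_rank_empty [simp]: "graph_rank V {} = 0"
proof -
  have "components V {} = (\<lambda>u. {u}) ` V"
    by (auto simp: components_def conn_def)
  then show ?thesis by (simp add: graph_rank_def card_image)
qed

text \<open>Most facts about the rank below follow from this rule by adding edges one at a
  time.\<close>

lemma graph_rank_insert:
  assumes "finite V" "a \<in> V" "b \<in> V"
  shows "graph_rank V (insert {a, b} E) = (if (a, b) \<in> conn E then graph_rank V E else Suc (graph_rank V E))"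
  using card_components_insert[OF assms, of E] card_components_le[OF assms(1), of E]
    components_insert_connected[of a b E V]
  by (auto simp: graph_rank_def)

lemma nsets_2E:
  assumes "e \<in> nsets V 2"
  obtains a b where "e = {a, b}" "a \<in> V" "b \<in> V" "a \<noteq> b"
  using assms by (auto simp: nsets_def card_2_iff)

lemma finite_edges: "finite V \<Longrightarrow> E \<subseteq> nsets V 2 \<Longrightarrow> finite E"
  by (meson finite_imp_finite_nsets finite_subset)

lemma graph_rank_insert_le:
  assumes "finite V" "e \<in> nsets V 2"
  shows "graph_rank V (insert e E) \<le> Suc (graph_rank V E)"
  using assms by (elim nsets_2E) (simp add: graph_rank_insert)

lemma graph_rank_le_card:
  assumes "finite V" "E \<subseteq> nsets V 2"
  shows "graph_rank V E \<le> card E"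
proof -
  have "finite E" using assms by (rule finite_edges)
  then show ?thesis using assms(2)
  proof induction
    case (insert e E)
    then show ?case using graph_rank_insert_le[OF assms(1), of e E] by simp
  qed simp
qed

lemma graph_rank_mono:
  assumes "finite V" "F \<subseteq> nsets V 2" "E \<subseteq> F"
  shows "graph_rank V E \<le> graph_rank V F"
proof -
  have "graph_rank V E \<le> graph_rank V (E \<union> X)" if "finite X" "X \<subseteq> nsets V 2" for X
    using that
  proof induction
    case (insert e X)
    from insert.prems have "e \<in> nsets V 2" by simp
    then have "graph_rank V (E \<union> X) \<le> graph_rank V (insert e (E \<union> X))"
      by (elim nsets_2E) (simp add: graph_rank_insert assms(1))
    then show ?case using insert by simp
  qed simp
  from this[of F] show ?thesis using assms finite_edges[of V F] by (simp add: Un_absorb1)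
qed

text \<open>
  Submodularity holds because adding an edge raises the rank unless its ends are already connected,
  which is more likely in a larger graph.
\<close>

lemma graph_rank_submodular:
  assumes "finite V" "A \<subseteq> nsets V 2" "B \<subseteq> nsets V 2"
  shows "graph_rank V (A \<union> B) + graph_rank V (A \<inter> B) \<le> graph_rank V A + graph_rank V B"
proof -
  have "graph_rank V (B \<union> X) + graph_rank V (A \<inter> B) \<le> graph_rank V ((A \<inter> B) \<union> X) + graph_rank V B"
    if "finite X" "X \<subseteq> nsets V 2" for X
    using that
  proof induction
    case (insert e X)
    from insert.prems have "e \<in> nsets V 2" by simp
    then obtain a b where e: "e = {a, b}" "a \<in> V" "b \<in> V" by (elim nsets_2E)
    have "conn ((A \<inter> B) \<union> X) \<subseteq> conn (B \<union> X)" by (rule conn_mono) auto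
    then show ?case
      using insert graph_rank_insert[OF assms(1) e(2,3)] by (auto simp: e(1))
  qed simp
  \<comment> \<open>For \<open>X = A\<close> the two growing sets have become
    \<open>A \<union> B\<close> and \<open>A\<close>.\<close>
  from this[of A] show ?thesis using assms finite_edges[of V A]
    by (simp add: Un_commute Un_absorb2)
qed

section \<open>Forests and spanning trees in terms of the rank\<close>

lemma walk_conn: "walk E p \<Longrightarrow> (hd p, last p) \<in> conn E"
proof (induction p)
  case (Cons x p)
  then show ?case
    by (cases p) (auto simp: walk_def intro: conn_trans conn_edge)
qed (simp add: walk_def)

lemma conn_imp_path:
  assumes "(u, v) \<in> conn E"
  shows "\<exists>p. walk E p \<and> distinct p \<and> hd p = u \<and> last p = v"
  using assms unfolding conn_def
proof (induction rule: converse_rtrancl_induct)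
  case base
  have "walk E [v] \<and> distinct [v] \<and> hd [v] = v \<and> last [v] = v" by (simp add: walk_def)
  then show ?case by blast
next
  case (step x y)
  then obtain p where p: "walk E p" "distinct p" "hd p = y" "last p = v" by blast
  show ?case
  proof (cases "x \<in> set p")
    case True
    \<comment> \<open>The part of \<open>p\<close> from \<open>x\<close> on is already a path from
      \<open>x\<close> to \<open>v\<close>.\<close>
    then obtain as bs where "p = as @ x # bs" by (meson split_list)
    then have "walk E (x # bs) \<and> distinct (x # bs) \<and> hd (x # bs) = x \<and> last (x # bs) = v"
      using p by (auto simp: walk_def successively_append_iff)
    then show ?thesis by blast
  next
    case False
    then have "walk E (x # p) \<and> distinct (x # p) \<and> hd (x # p) = x \<and> last (x # p) = v"
      using p step.hyps by (auto simp: walk_def successively_Cons)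
    then show ?thesis by blast
  qed
qed

lemma walk_mono: "walk E p \<Longrightarrow> E \<subseteq> F \<Longrightarrow> walk F p"
  unfolding walk_def using successively_mono by (metis (no_types, lifting) subset_iff)

lemma acyclic_graph_mono: "acyclic_graph F \<Longrightarrow> E \<subseteq> F \<Longrightarrow> acyclic_graph E"
  unfolding acyclic_graph_def cycle_def using walk_mono by blast

text \<open>A path from \<open>a\<close> to \<open>b\<close> in \<open>E\<close> would close to a
  cycle with the new edge. It has at least three vertices because \<open>a \<noteq> b\<close> and
  \<open>{a, b}\<close> is not in \<open>E\<close>.\<close>

lemma acyclic_graph_insertD:
  assumes "acyclic_graph (insert {a, b} E)" "{a, b} \<notin> E" "a \<noteq> b"
  shows "(a, b) \<notin> conn E"
proof
  assume "(a, b) \<in> conn E"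
  then obtain p where p: "walk E p" "distinct p" "hd p = a" "last p = b"
    using conn_imp_path by metis
  have "3 \<le> length p"
  proof (rule ccontr)
    assume "\<not> 3 \<le> length p"
    then consider "length p = 0" | "length p = 1" | "length p = 2" by linarith
    then show False
      using p assms by cases (auto simp: walk_def length_Suc_conv numeral_2_eq_2)
  qed
  then have "cycle (insert {a, b} E) p"
    using p walk_mono[OF p(1), of "insert {a, b} E"]
    by (auto simp: cycle_def insert_commute)
  then show False using assms(1) by (auto simp: acyclic_graph_def)
qed

text \<open>When a forest is built up edge by edge, every edge joins two different
  components.\<close>

lemma graph_rank_acyclic:
  assumes "finite V" "E \<subseteq> nsets V 2" "acyclic_graph E"
  shows "graph_rank V E = card E"
proof -
  have "finite E" using assms finite_edges by blast
  then show ?thesis using assms(2,3)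
  proof induction
    case (insert e E)
    then have "e \<in> nsets V 2" by simp
    then obtain a b where e: "e = {a, b}" "a \<in> V" "b \<in> V" "a \<noteq> b" by (elim nsets_2E)
    have "(a, b) \<notin> conn E" using acyclic_graph_insertD insert e by metis
    moreover have "acyclic_graph E" using insert.prems acyclic_graph_mono by blast
    ultimately show ?case using insert graph_rank_insert[OF assms(1) e(2,3)] e(1) by simp
  qed simp
qed

text \<open>The closing edge of a cycle joins vertices that are connected without it, so removing it
  keeps the rank and lowers the cardinality.\<close>

lemma acyclic_if_graph_rank_eq_card:
  assumes "finite V" "E \<subseteq> nsets V 2" "graph_rank V E = card E"
  shows "acyclic_graph E"
proof (rule ccontr)
  assume "\<not> acyclic_graph E"
  then obtain p where p: "3 \<le> length p" "distinct p" "walk E p" "{last p, hd p} \<in> E"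
    by (auto simp: acyclic_graph_def cycle_def)
  let ?F = "E - {{last p, hd p}}"
  have "p \<noteq> []" using p by auto
  have "walk ?F p"
    unfolding walk_def
  proof (intro conjI \<open>p \<noteq> []\<close>)
    show "successively (\<lambda>u v. {u, v} \<in> ?F) p"
      unfolding successively_conv_nth
    proof (intro allI impI)
      fix i assume i: "Suc i < length p"
      have "{p ! i, p ! Suc i} \<in> E"
        using p(3) i by (auto simp: walk_def successively_conv_nth)
      \<comment> \<open>Equality would make the first and last positions of \<open>p\<close>
        adjacent, which three or more distinct vertices exclude.\<close>
      moreover have "{p ! i, p ! Suc i} \<noteq> {last p, hd p}"
        using i p(1) \<open>p \<noteq> []\<close> nth_eq_iff_index_eq[OF p(2)]
        by (auto simp: doubleton_eq_iff last_conv_nth hd_conv_nth)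
      ultimately show "{p ! i, p ! Suc i} \<in> ?F" by simp
    qed
  qed
  then have "(last p, hd p) \<in> conn ?F" using walk_conn conn_commute by metis
  moreover have "insert {last p, hd p} ?F = E" using p(4) by blast
  moreover have "last p \<in> V" "hd p \<in> V" using p(4) assms(2) by (auto simp: nsets_def)
  ultimately have "graph_rank V E = graph_rank V ?F"
    using graph_rank_insert[OF assms(1), of "last p" "hd p" ?F] by simp
  also have "\<dots> \<le> card ?F" using assms by (intro graph_rank_le_card) auto
  also have "\<dots> < card E"
    using p(4) finite_edges[OF assms(1,2)] by (meson card_Diff1_less)
  finally show False using assms(3) by simp
qed

text \<open>Rank equal to cardinality makes \<open>T\<close> a forest; with one edge fewer than
  vertices, this rank leaves a single component.\<close>

lemma spanning_tree_if_graph_rank: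
  assumes "finite V" "V \<noteq> {}" "T \<subseteq> nsets V 2" "graph_rank V T = card T" "Suc (card T) = card V"
  shows "spanning_tree V T"
  unfolding spanning_tree_def
proof (intro conjI)
  show "acyclic_graph T" using assms(1,3,4) by (rule acyclic_if_graph_rank_eq_card)
  have "card (components V T) = 1"
    using assms(4,5) card_components_le[OF assms(1), of T] by (simp add: graph_rank_def)
  then obtain X where "components V T = {X}" by (rule card_1_singletonE)
  then have X: "conn T `` {u} = X" if "u \<in> V" for u
    using that by (auto simp: components_def)
  have "\<exists>p. walk T p \<and> hd p = u \<and> last p = v" if "u \<in> V" "v \<in> V" for u v
  proof -
    have "(u, v) \<in> conn T" using X[OF that(1)] X[OF that(2)] conn_class_eq_iff by metis
    then show ?thesis using conn_imp_path by metis
  qed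
  then show "connected_graph V T"
    using assms(2) by (simp add: connected_graph_def)
qed (use assms in simp)

text \<open>Taken over the incident vertices \<open>\<Union>E\<close> alone, the rank is still
  \<open>card E\<close>, and at least one component is subtracted in its definition.\<close>

lemma card_vertices_acyclic:
  assumes "finite V" "E \<subseteq> nsets V 2" "acyclic_graph E" "E \<noteq> {}"
  shows "card E < card (\<Union>E)"
proof -
  have fin: "finite (\<Union>E)"
    using assms(1,2) by (auto simp: nsets_def intro: finite_subset[of _ V])
  have "E \<subseteq> nsets (\<Union>E) 2" using assms(2) by (auto simp: nsets_def)
  then have "card E = graph_rank (\<Union>E) E" using graph_rank_acyclic fin assms(3) by metis
  moreover obtain e where "e \<in> E" using assms(4) by blast
  then have "e \<noteq> {}" using assms(2) by (auto simp: nsets_def)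
  then have "\<Union>E \<noteq> {}" using \<open>e \<in> E\<close> by blast
  then have "card (components (\<Union>E) E) > 0" "card (\<Union>E) > 0"
    using fin by (auto simp: components_def card_gt_0_iff)
  ultimately show ?thesis by (simp add: graph_rank_def)
qed

section \<open>Rank of unions\<close>

text \<open>The vertices of \<open>W\<close> are isolated in \<open>E\<close>. Adding one edge of
  \<open>D\<close> from each of them to a vertex outside \<open>W\<close> raises the rank every
  time.\<close>

lemma graph_rank_Un_pendant:
  assumes "finite V" "E \<subseteq> nsets V 2" "D \<subseteq> nsets V 2" "W \<subseteq> V" "W \<inter> \<Union>E = {}"
    and "\<And>w. w \<in> W \<Longrightarrow> \<exists>u \<in> V - W. {w, u} \<in> D"
  shows "graph_rank V E + card W \<le> graph_rank V (E \<union> D)"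
proof -
  obtain f where f: "\<And>w. w \<in> W \<Longrightarrow> f w \<in> V - W \<and> {w, f w} \<in> D"
    using assms(6) by metis
  have "finite W" using assms by (meson finite_subset)
  have "graph_rank V E + card X \<le> graph_rank V (E \<union> (\<lambda>w. {w, f w}) ` X)" if "finite X" "X \<subseteq> W" for X
    using that
  proof induction
    case (insert x X)
    let ?F = "E \<union> (\<lambda>w. {w, f w}) ` X"
    have "x \<in> W" using insert.prems by simp
    \<comment> \<open>The edges added so far have their other ends outside \<open>W\<close>, so
      \<open>x\<close> is still isolated.\<close>
    have "f w \<noteq> x" if "w \<in> X" for w using f[of w] that \<open>x \<in> W\<close> insert.prems by auto
    then have "x \<notin> \<Union>?F" using insert.hyps \<open>x \<in> W\<close> assms(5) by auto
    moreover have "f x \<noteq> x" using f[of x] \<open>x \<in> W\<close> by auto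
    ultimately have "(x, f x) \<notin> conn ?F" using conn_eq_if_not_incident[of x "f x" ?F] by blast
    then have "graph_rank V (insert {x, f x} ?F) = Suc (graph_rank V ?F)"
      using graph_rank_insert[OF assms(1), of x "f x" ?F] f \<open>x \<in> W\<close> assms(4) by auto
    then show ?case using insert by simp
  qed simp
  from this[OF \<open>finite W\<close>] have "graph_rank V E + card W \<le> graph_rank V (E \<union> (\<lambda>w. {w, f w}) ` W)" by simp
  also have "\<dots> \<le> graph_rank V (E \<union> D)"
    using assms f by (intro graph_rank_mono) auto
  finally show ?thesis .
qed

text \<open>A walk that starts in \<open>U\<close> cannot use an edge of \<open>A\<close>, and the
  edges of \<open>B\<close> keep it inside \<open>U\<close>.\<close>

lemma conn_Un_disjoint:
  assumes "\<Union>A \<inter> U = {}" "\<Union>B \<subseteq> U" "(u, v) \<in> conn (A \<union> B)" "u \<in> U"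
  shows "v \<in> U \<and> (u, v) \<in> conn B"
  using assms(3) unfolding conn_def[of "_ \<union> _"]
proof (induction rule: rtrancl_induct)
  case (step y z)
  then have "{y, z} \<in> B" using assms(1) by auto
  then show ?case using step.IH assms(2) by (auto intro: conn_trans conn_edge)
qed (simp add: assms(4))

text \<open>No edge of \<open>A\<close> helps to connect the ends of an edge of \<open>B\<close>, so
  the edges of \<open>B\<close> raise the rank over \<open>A\<close> exactly as they do on their
  own.\<close>

lemma graph_rank_Un_disjoint:
  assumes "finite V" "A \<subseteq> nsets V 2" "B \<subseteq> nsets V 2" "\<Union>A \<inter> \<Union>B = {}"
  shows "graph_rank V (A \<union> B) = graph_rank V A + graph_rank V B"
proof -
  have "graph_rank V (A \<union> X) = graph_rank V A + graph_rank V X" if "finite X" "X \<subseteq> B" for X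
    using that
  proof induction
    case (insert e X)
    then have "e \<in> nsets V 2" using assms by auto
    then obtain a b where e: "e = {a, b}" "a \<in> V" "b \<in> V" by (elim nsets_2E)
    have "(a, b) \<in> conn (A \<union> X) \<longleftrightarrow> (a, b) \<in> conn X"
    proof
      assume *: "(a, b) \<in> conn (A \<union> X)"
      have "\<Union>X \<subseteq> \<Union>B" "a \<in> \<Union>B" using insert.prems e by auto
      then show "(a, b) \<in> conn X" using conn_Un_disjoint[OF assms(4) _ *] by blast
    next
      assume "(a, b) \<in> conn X"
      then show "(a, b) \<in> conn (A \<union> X)" using conn_mono[of X "A \<union> X"] by blast
    qed
    then show ?case
      using insert graph_rank_insert[OF assms(1) e(2,3)] by (simp add: e(1))
  qed simp
  from this[of B] show ?thesis using assms finite_edges by blast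
qed

section \<open>Rado's theorem on independent transversals\<close>

text \<open>
  Rado's proof: by submodularity, from a member \<open>A k\<close> with two elements \<open>x\<close> and \<open>y\<close> one of them can be
  removed without violating the condition \<open>hall\<close>. This ends with singletons, which form the
  transversal.
\<close>

theorem rado_transversal:
  fixes r :: "'b set \<Rightarrow> nat" and A :: "'i \<Rightarrow> 'b set"
  assumes "finite S" "finite I" "\<And>i. i \<in> I \<Longrightarrow> A i \<subseteq> S"
    and mono: "\<And>X Y. Y \<subseteq> S \<Longrightarrow> X \<subseteq> Y \<Longrightarrow> r X \<le> r Y"
    and submod: "\<And>X Y. X \<subseteq> S \<Longrightarrow> Y \<subseteq> S \<Longrightarrow> r (X \<union> Y) + r (X \<inter> Y) \<le> r X + r Y"
    and empty: "r {} = 0"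
    and hall: "\<And>J. J \<subseteq> I \<Longrightarrow> card J \<le> r (\<Union>i\<in>J. A i)"
  shows "\<exists>f. (\<forall>i\<in>I. f i \<in> A i) \<and> card I \<le> r (f ` I)"
  using assms(3) hall
\<comment> \<open>The total size of the sets decreases with each removal of an element.\<close>
proof (induction "\<Sum>i\<in>I. card (A i)" arbitrary: A rule: less_induct)
  case less
  have fin: "finite (A i)" if "i \<in> I" for i
    using less.prems(1)[OF that] \<open>finite S\<close> by (rule finite_subset)
  have ne: "A i \<noteq> {}" if "i \<in> I" for i
    using less.prems(2)[of "{i}"] that empty by auto
  show ?case
  proof (cases "\<forall>i\<in>I. is_singleton (A i)")
    case True
    define f where "f i = the_elem (A i)" for i
    have A: "A i = {f i}" if "i \<in> I" for i
      using True that by (simp add: f_def is_singleton_the_elem)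
    have "(\<Union>i\<in>I. A i) = f ` I" using A by auto
    then have "card I \<le> r (f ` I)" using less.prems(2)[of I] by simp
    then show ?thesis using A by blast
  next
    case False
    then obtain k where k: "k \<in> I" "\<not> is_singleton (A k)" by blast
    then obtain x y where xy: "x \<in> A k" "y \<in> A k" "x \<noteq> y"
      using ne by (metis ex_in_conv is_singletonI')
    define B where "B z = A(k := A k - {z})" for z
    \<comment> \<open>Without a transversal, the induction hypothesis cannot apply to
      \<open>A\<close> with \<open>z\<close> removed from \<open>A k\<close>, so \<open>hall\<close>
      breaks there at some index set. It contains \<open>k\<close>, since otherwise none of its
      members has changed; \<open>J\<close> is the rest of it.\<close>
    have fail: "\<exists>J \<subseteq> I - {k}. r ((\<Union>i\<in>J. A i) \<union> (A k - {z})) \<le> card J"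
      if z: "z \<in> A k" "\<not> (\<exists>f. (\<forall>i\<in>I. f i \<in> A i) \<and> card I \<le> r (f ` I))" for z
    proof (rule ccontr)
      assume neg: "\<not> ?thesis"
      have "(\<Sum>i\<in>I. card (B z i)) < (\<Sum>i\<in>I. card (A i))"
      proof (rule sum_strict_mono_ex1[OF \<open>finite I\<close>])
        show "\<forall>i\<in>I. card (B z i) \<le> card (A i)"
          by (simp add: B_def card_Diff1_le)
        show "\<exists>i\<in>I. card (B z i) < card (A i)"
          using k(1) z(1) fin[OF k(1)] by (intro bexI[of _ k]) (simp_all add: B_def card_Diff1_less del: card_Diff_insert)
      qed
      moreover have "B z i \<subseteq> S" if "i \<in> I" for i
        using less.prems(1)[OF that] by (auto simp: B_def)
      moreover have "card J \<le> r (\<Union>i\<in>J. B z i)" if J: "J \<subseteq> I" for J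
      proof (cases "k \<in> J")
        case True
        have "(\<Union>i\<in>J. B z i) = (\<Union>i\<in>J - {k}. A i) \<union> (A k - {z})"
          using True by (auto simp: B_def split: if_splits)
        moreover have "J - {k} \<subseteq> I - {k}" using J by blast
        then have "card (J - {k}) < r ((\<Union>i\<in>J - {k}. A i) \<union> (A k - {z}))"
          using neg not_le by blast
        moreover have "card J = Suc (card (J - {k}))"
          using True J \<open>finite I\<close> by (intro card.remove) (auto intro: finite_subset)
        ultimately show ?thesis by simp
      next
        case False
        then have "(\<Union>i\<in>J. B z i) = (\<Union>i\<in>J. A i)" by (auto simp: B_def split: if_splits)
        then show ?thesis using less.prems(2)[OF J] by simp
      qed
      ultimately have "\<exists>f. (\<forall>i\<in>I. f i \<in> B z i) \<and> card I \<le> r (f ` I)"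
        by (rule less.hyps)
      moreover have "B z i \<subseteq> A i" for i by (auto simp: B_def)
      ultimately show False using z(2) by (meson subsetD)
    qed
    show ?thesis
    proof (rule ccontr)
      assume no: "\<not> ?thesis"
      obtain J where J: "J \<subseteq> I - {k}" "r ((\<Union>i\<in>J. A i) \<union> (A k - {x})) \<le> card J"
        using fail[OF xy(1) no] by blast
      obtain K where K: "K \<subseteq> I - {k}" "r ((\<Union>i\<in>K. A i) \<union> (A k - {y})) \<le> card K"
        using fail[OF xy(2) no] by blast
      let ?X = "(\<Union>i\<in>J. A i) \<union> (A k - {x})" and ?Y = "(\<Union>i\<in>K. A i) \<union> (A k - {y})"
      have sub: "?X \<subseteq> S" "?Y \<subseteq> S" using J(1) K(1) k(1) less.prems(1) by blast+
      have finJK: "finite J" "finite K" using J(1) K(1) \<open>finite I\<close> by (auto intro: finite_subset)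
      have "card (insert k (J \<union> K)) \<le> r (\<Union>i\<in>insert k (J \<union> K). A i)"
        using J(1) K(1) k(1) by (intro less.prems(2)) auto
      \<comment> \<open>Since \<open>x \<noteq> y\<close>, the two reduced copies of
        \<open>A k\<close> unite to all of \<open>A k\<close>, so the index \<open>k\<close> counts
        as well.\<close>
      also have "(\<Union>i\<in>insert k (J \<union> K). A i) = ?X \<union> ?Y" using xy by auto
      finally have 1: "Suc (card (J \<union> K)) \<le> r (?X \<union> ?Y)"
        using J(1) K(1) finJK by (subst (asm) card_insert_disjoint) auto
      have "card (J \<inter> K) \<le> r (\<Union>i\<in>J \<inter> K. A i)"
        using J(1) by (intro less.prems(2)) auto
      also have "\<dots> \<le> r (?X \<inter> ?Y)"
        using sub by (intro mono) auto
      finally have 2: "card (J \<inter> K) \<le> r (?X \<inter> ?Y)" .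
      have "card (J \<union> K) + card (J \<inter> K) = card J + card K"
        using card_Un_Int[OF finJK] by simp
      \<comment> \<open>Submodularity would give \<open>card (J \<union> K) + 1 + card (J \<inter>
        K) \<le> card J + card K\<close>.\<close>
      then show False using 1 2 submod[OF sub] J(2) K(2) by linarith
    qed
  qed
qed


section \<open>Counting colours of one parity\<close>

text \<open>These are the numbers \<open>p - 2 * k\<close> with \<open>l + 2 * k \<le> p\<close>.
  Truncated subtraction makes the formula correct for \<open>l > p\<close> too.\<close>

lemma card_same_parity:
  "card {j \<in> {l..p}. j mod 2 = p mod 2} = (p + 2 - l) div 2" for l p :: nat
proof -
  have less_iff: "k < (p + 2 - l) div 2 \<longleftrightarrow> l + 2 * k \<le> p" for k
    using less_eq_div_iff_mult_less_eq[of 2 "Suc k" "p + 2 - l"] by (simp add: Suc_le_eq) linarith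
  have "{j \<in> {l..p}. j mod 2 = p mod 2} = (\<lambda>k. p - 2 * k) ` {..<(p + 2 - l) div 2}" (is "?L = ?R")
  proof
    show "?R \<subseteq> ?L"
    proof
      fix j assume "j \<in> ?R"
      then obtain k where k: "l + 2 * k \<le> p" "j = p - 2 * k" unfolding less_iff[symmetric] by blast
      then have "p = j + 2 * k" by simp
      then show "j \<in> ?L" using k(1) by simp
    qed
    show "?L \<subseteq> ?R"
    proof
      fix j assume "j \<in> ?L"
      then have j: "l \<le> j" "j \<le> p" "j mod 2 = p mod 2" by auto
      then have "2 dvd p - j" using mod_eq_dvd_iff_nat[of j p 2] by simp
      then obtain k where k: "p - j = 2 * k" by (rule dvdE)
      then have "j = p - 2 * k" "k < (p + 2 - l) div 2" using j unfolding less_iff by simp_all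
      then show "j \<in> ?R" by blast
    qed
  qed
  moreover have "inj_on (\<lambda>k. p - 2 * k) {..<(p + 2 - l) div 2}"
  proof (rule inj_onI, unfold lessThan_iff less_iff)
    fix k k' assume "l + 2 * k \<le> p" "l + 2 * k' \<le> p" "p - 2 * k = p - 2 * k'"
    then show "k = k'" by linarith
  qed
  ultimately show ?thesis by (simp add: card_image)
qed

lemma card_same_parity_le:
  fixes p :: nat
  assumes "\<And>j. j \<in> J \<Longrightarrow> l \<le> j \<and> j \<le> p \<and> j mod 2 = p mod 2"
  shows "card J \<le> (p + 2 - l) div 2"
  unfolding card_same_parity[symmetric] using assms by (intro card_mono) auto

section \<open>Rado's condition for the colour classes\<close>

text \<open>Each class not congruent to \<open>n\<close> is cut down to one side, \<open>V1\<close>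
  for colours in \<open>S\<close>. Colour 1 is kept out of \<open>S\<close> because, if not
  congruent to \<open>n\<close>, it has \<open>1 div 2 = 0\<close> edges inside
  \<open>V1\<close>.\<close>

lemma card_le_graph_rank_chosen_sides:
  fixes C A :: "nat \<Rightarrow> 'a set set"
  assumes "finite V" and V12: "V1 \<union> V2 = V" "V1 \<inter> V2 = {}"
    and edges: "\<And>i. i \<in> {1..n} \<Longrightarrow> C i \<subseteq> nsets V 2"
    and acyc: "\<And>i. i \<in> {1..n} \<Longrightarrow> acyclic_graph (C i)"
    and card_C: "\<And>i. i \<in> {1..n} \<Longrightarrow> card (C i) = i"
    and bip: "\<And>i e. i \<in> {1..n} \<Longrightarrow> i mod 2 = n mod 2 \<Longrightarrow> e \<in> C i \<Longrightarrow>
                \<exists>u\<in>V1. \<exists>v\<in>V2. e = {u, v}"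
    and halves: "\<And>i. i \<in> {1..n} \<Longrightarrow> i mod 2 = n mod 2 \<Longrightarrow>
        card (\<Union>(C i) \<inter> V1) = card (\<Union>(C i)) div 2 \<and>
        card (\<Union>(C i) \<inter> V2) = (card (\<Union>(C i)) + 1) div 2"
    and sides: "\<And>i. i \<in> {1..n} \<Longrightarrow> i mod 2 \<noteq> n mod 2 \<Longrightarrow>
        card (C i \<inter> nsets V1 2) = i div 2 \<and> card (C i \<inter> nsets V2 2) = (i + 1) div 2"
    and S: "1 \<notin> S" and J: "J \<subseteq> {1..n}"
    and A: "\<And>i. A i = (if i mod 2 = n mod 2 then C i else
              if i \<in> S then C i \<inter> nsets V1 2 else C i \<inter> nsets V2 2)"
  shows "card J \<le> graph_rank V (\<Union>i\<in>J. A i)"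
proof -
  define R where "R = graph_rank V (\<Union>i\<in>J. A i)"
  \<comment> \<open>\<open>J0\<close> collects the uncut classes, \<open>J1\<close> and
    \<open>J2\<close> those cut down to \<open>V1\<close> and to \<open>V2\<close>.\<close>
  define J0 where "J0 = {j \<in> J. j mod 2 = n mod 2}"
  define J1 where "J1 = {j \<in> J. j mod 2 \<noteq> n mod 2 \<and> j \<in> S}"
  define J2 where "J2 = {j \<in> J. j mod 2 \<noteq> n mod 2 \<and> j \<notin> S}"
  have "finite J" using J by (rule finite_subset) simp
  then have fin: "finite J0" "finite J1" "finite J2"
    by (auto simp: J0_def J1_def J2_def)
  have J12: "J1 \<union> J2 = {j \<in> J. j mod 2 \<noteq> n mod 2}" by (auto simp: J1_def J2_def)
  have "J = J0 \<union> (J1 \<union> J2)" "J0 \<inter> (J1 \<union> J2) = {}" "J1 \<inter> J2 = {}"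
    by (auto simp: J0_def J1_def J2_def)
  then have card_J: "card J = card J0 + card (J1 \<union> J2)" "card (J1 \<union> J2) = card J1 + card J2"
    using fin by (simp_all add: card_Un_disjoint)
  have A_edges: "A i \<subseteq> nsets V 2" if "i \<in> J" for i
  proof -
    have "i \<in> {1..n}" using that J by blast
    then have "C i \<subseteq> nsets V 2" by (rule edges)
    moreover have "A i \<subseteq> C i" by (auto simp: A)
    ultimately show ?thesis by blast
  qed
  have R_mono: "graph_rank V X \<le> R" if "X \<subseteq> (\<Union>i\<in>J. A i)" for X
    unfolding R_def using \<open>finite V\<close> A_edges that by (intro graph_rank_mono) auto
  have graph_rank_A: "graph_rank V (A i) = card (A i)" if "i \<in> J" for i
  proof -
    have "i \<in> {1..n}" using that J by blast
    then have "acyclic_graph (C i)" by (rule acyc)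
    moreover have "A i \<subseteq> C i" by (auto simp: A)
    ultimately have "acyclic_graph (A i)" by (rule acyclic_graph_mono)
    then show ?thesis using \<open>finite V\<close> A_edges[OF that] by (intro graph_rank_acyclic)
  qed
  have card_J0: "card J0 \<le> (a + 1) div 2" if "a \<in> J0" "\<And>j. j \<in> J0 \<Longrightarrow> j \<le> a" for a
    using card_same_parity_le[of J0 1 a] that J by (force simp: J0_def)
  have card_J12: "card (J1 \<union> J2) \<le> (p + 1) div 2"
    if "p \<in> J1 \<union> J2" "\<And>j. j \<in> J1 \<union> J2 \<Longrightarrow> j \<le> p" for p
  proof -
    have "1 \<le> j \<and> j \<le> p \<and> j mod 2 = p mod 2" if "j \<in> J1 \<union> J2" for j
    proof -
      have "j \<in> J" "j mod 2 \<noteq> n mod 2" "p mod 2 \<noteq> n mod 2"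
        using that \<open>p \<in> J1 \<union> J2\<close> unfolding J12 by auto
      moreover from this have "j mod 2 = p mod 2" by (auto simp: mod2_eq_if split: if_splits)
      ultimately show ?thesis using \<open>j \<in> J1 \<union> J2 \<Longrightarrow> j \<le> p\<close> that J by auto
    qed
    then show ?thesis using card_same_parity_le[of "J1 \<union> J2" 1 p] by simp
  qed
  have J1_A: "card J1 \<le> card (A p)" if "p \<in> J1" "\<And>j. j \<in> J1 \<Longrightarrow> j \<le> p" for p
  proof -
    \<comment> \<open>Starting from 2 instead of 1 lowers the count from
      \<open>(p + 1) div 2\<close> to \<open>p div 2\<close> for odd \<open>p\<close>;
      \<open>A p\<close> has only \<open>p div 2\<close> edges.\<close>
    have "2 \<le> j \<and> j \<le> p \<and> j mod 2 = p mod 2" if "j \<in> J1" for j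
    proof -
      have "j \<noteq> 1" "j \<ge> 1" using that S J by (auto simp: J1_def)
      moreover have "j mod 2 = p mod 2"
        using that \<open>p \<in> J1\<close> unfolding J1_def by (auto simp: mod2_eq_if split: if_splits)
      ultimately show ?thesis using \<open>j \<in> J1 \<Longrightarrow> j \<le> p\<close> that by simp
    qed
    then have "card J1 \<le> p div 2" using card_same_parity_le[of J1 2 p] by simp
    also have "\<dots> = card (A p)" using \<open>p \<in> J1\<close> J sides[of p] by (auto simp: J1_def A)
    finally show ?thesis .
  qed
  have J2_A: "card J2 \<le> card (A p)" if "p \<in> J2" "\<And>j. j \<in> J2 \<Longrightarrow> j \<le> p" for p
  proof -
    have "1 \<le> j \<and> j \<le> p \<and> j mod 2 = p mod 2" if "j \<in> J2" for j
    proof -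
      have "j \<ge> 1" using that J by (auto simp: J2_def)
      moreover have "j mod 2 = p mod 2"
        using that \<open>p \<in> J2\<close> unfolding J2_def by (auto simp: mod2_eq_if split: if_splits)
      ultimately show ?thesis using \<open>j \<in> J2 \<Longrightarrow> j \<le> p\<close> that by simp
    qed
    then have "card J2 \<le> (p + 1) div 2" using card_same_parity_le[of J2 1 p] by simp
    also have "\<dots> = card (A p)" using \<open>p \<in> J2\<close> J sides[of p] by (auto simp: J2_def A)
    finally show ?thesis .
  qed
  \<comment> \<open>For these colours the largest class on each side suffices: two forests on
    disjoint vertex sets, whose ranks add up.\<close>
  have bound12: "card (J1 \<union> J2) \<le> R"
  proof (cases "J1 = {} \<or> J2 = {}")
    case True
    show ?thesis
    proof (cases "J1 \<union> J2 = {}")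
      case False
      define p where "p = Max (J1 \<union> J2)"
      have p: "p \<in> J1 \<union> J2" "\<And>j. j \<in> J1 \<union> J2 \<Longrightarrow> j \<le> p"
        using False fin unfolding p_def by (auto intro!: Max_in simp del: Un_iff)
      have "card (J1 \<union> J2) \<le> card (A p)" using True J1_A[of p] J2_A[of p] p by auto
      also have "\<dots> \<le> R" using p(1) graph_rank_A[of p] R_mono[of "A p"] unfolding J12 by auto
      finally show ?thesis .
    qed simp
  next
    case False
    define p q where "p = Max J1" and "q = Max J2"
    have p: "p \<in> J1" "\<And>j. j \<in> J1 \<Longrightarrow> j \<le> p" and q: "q \<in> J2" "\<And>j. j \<in> J2 \<Longrightarrow> j \<le> q"
      using False fin by (auto simp: p_def q_def)
    have pq: "p \<in> J" "q \<in> J" using p q by (auto simp: J1_def J2_def)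
    have "\<Union>(A p) \<subseteq> V1" "\<Union>(A q) \<subseteq> V2"
      using p q by (auto simp: A J1_def J2_def nsets_def)
    then have "graph_rank V (A p \<union> A q) = card (A p) + card (A q)"
      using \<open>finite V\<close> V12 A_edges graph_rank_A pq by (subst graph_rank_Un_disjoint) auto
    moreover have "graph_rank V (A p \<union> A q) \<le> R" using pq by (intro R_mono) auto
    ultimately show ?thesis using J1_A[OF p] J2_A[OF q] card_J(2) by linarith
  qed
  have "card J \<le> R"
  proof (cases "J0 = {}")
    case True
    then show ?thesis using card_J bound12 by simp
  next
    case False
    define a where "a = Max J0"
    have a: "a \<in> J0" "\<And>j. j \<in> J0 \<Longrightarrow> j \<le> a" using False fin by (auto simp: a_def)
    then have aJ: "a \<in> J" "a \<in> {1..n}" "a mod 2 = n mod 2" using J by (auto simp: J0_def)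
    have A_a: "A a = C a" using aJ by (simp add: A)
    have "A a \<subseteq> (\<Union>i\<in>J. A i)" using aJ(1) by blast
    then have "a \<le> R" using graph_rank_A[OF aJ(1)] R_mono[of "A a"] card_C[OF aJ(2)] by (simp add: A_a)
    show ?thesis
    proof (cases "J1 \<union> J2 = {}")
      case True
      have "(a + 1) div 2 \<le> a" using aJ(2) by simp
      then show ?thesis
        using True card_J card_J0[OF a] \<open>a \<le> R\<close> by (simp del: Un_empty)
    next
      case False
      define p where "p = Max (J1 \<union> J2)"
      have p: "p \<in> J1 \<union> J2" "\<And>j. j \<in> J1 \<union> J2 \<Longrightarrow> j \<le> p"
        using False fin unfolding p_def by (auto intro!: Max_in simp del: Un_iff)
      then have pJ: "p \<in> J" "p \<in> {1..n}" "p mod 2 \<noteq> a mod 2" using aJ J unfolding J12 by auto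
      have card_le: "card J \<le> (a + 1) div 2 + (p + 1) div 2"
        using card_J(1) card_J0[OF a] card_J12[OF p] by simp
      show ?thesis
      proof (cases "p < a")
        case True
        \<comment> \<open>Exactly one of \<open>a\<close> and \<open>p\<close> is odd, so the sum is
          \<open>(a + p + 1) div 2\<close>, and \<open>p + 1 \<le> a\<close>.\<close>
        then have "(a + 1) div 2 + (p + 1) div 2 \<le> a"
          using pJ(3) by (cases "even a") (auto simp: mod2_eq_if elim!: evenE oddE split: if_splits)
        then show ?thesis using card_le \<open>a \<le> R\<close> by simp
      next
        case False
        \<comment> \<open>\<open>U\<close> is the side that contains \<open>A p\<close>. The
          vertices in \<open>W\<close> are therefore untouched by \<open>A p\<close>, and their
          neighbours in the bipartite \<open>C a\<close> lie in \<open>U\<close>.\<close>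
        define U W where "U = (if p \<in> S then V1 else V2)" and "W = \<Union>(C a) \<inter> (V - U)"
        have "\<exists>u \<in> V - W. {w, u} \<in> C a" if "w \<in> W" for w
        proof -
          have "w \<in> \<Union>(C a)" using that by (simp add: W_def)
          then obtain e where e: "e \<in> C a" "w \<in> e" by blast
          then obtain u v where "u \<in> V1" "v \<in> V2" "e = {u, v}" using bip aJ by blast
          then show ?thesis
            using e that V12 by (cases "p \<in> S") (auto simp: W_def U_def insert_commute)
        qed
        moreover have "W \<inter> \<Union>(A p) = {}"
          using pJ aJ by (auto simp: A W_def U_def nsets_def)
        ultimately have "graph_rank V (A p) + card W \<le> graph_rank V (A p \<union> C a)"
          using \<open>finite V\<close> A_edges pJ(1) edges[OF aJ(2)]
          by (intro graph_rank_Un_pendant) (auto simp: W_def)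
        also have "\<dots> \<le> R" using pJ aJ A_a by (intro R_mono) auto
        finally have R: "card (A p) + card W \<le> R" using graph_rank_A pJ(1) by simp
        have "C a \<noteq> {}" using card_C[OF aJ(2)] aJ(2) by auto
        then have verts: "a < card (\<Union>(C a))"
          using card_vertices_acyclic[OF \<open>finite V\<close> edges acyc] card_C aJ(2) by metis
        have "(a + 1) div 2 + (p + 1) div 2 \<le> card (A p) + card W"
        proof (cases "p \<in> S")
          case True
          then have "W = \<Union>(C a) \<inter> V2" using V12 by (auto simp: W_def U_def)
          then have "card W = (card (\<Union>(C a)) + 1) div 2" using halves aJ by simp
          moreover have "card (A p) = p div 2" using True pJ aJ sides[of p] by (simp add: A)
          moreover have "(a + 2) div 2 \<le> (card (\<Union>(C a)) + 1) div 2"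
            using verts by (intro div_le_mono) simp
          \<comment> \<open>For odd \<open>p\<close>, \<open>A p\<close> falls one short of
            \<open>(p + 1) div 2\<close>. Then \<open>a\<close> is even, and the larger half of at
            least \<open>a + 1\<close> vertices makes up for it.\<close>
          moreover have "(a + 1) div 2 + (p + 1) div 2 = p div 2 + (a + 2) div 2"
            using pJ(3) by (cases "even a") (auto simp: mod2_eq_if elim!: evenE oddE split: if_splits)
          ultimately show ?thesis by simp
        next
          case False
          then have "W = \<Union>(C a) \<inter> V1" using V12 by (auto simp: W_def U_def)
          then have "card W = card (\<Union>(C a)) div 2" using halves aJ by simp
          moreover have "card (A p) = (p + 1) div 2" using False pJ aJ sides[of p] by (simp add: A)
          moreover have "(a + 1) div 2 \<le> card (\<Union>(C a)) div 2"
            using verts by (intro div_le_mono) simp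
          ultimately show ?thesis by simp
        qed
        then show ?thesis using card_le R by simp
      qed
    qed
  qed
  then show ?thesis by (simp add: R_def)
qed

section \<open>Choices of sides and the trees they give\<close>

theorem theorem3:
  fixes n :: nat and V :: "'a set" and C :: "nat \<Rightarrow> 'a set set"
  assumes "n \<ge> 2"
    and "card V = n + 1"
    and "beautiful_colouring n V C"
  shows "card {T. spanning_tree V T \<and> heterochromatic n C T} \<ge> 2 ^ ((n - 1) div 2)"
proof -
  have V: "finite V" "V \<noteq> {}" using assms(2) by (auto intro: card_ge_0_finite)
  have part: "inj_on C {1..n}" "partition_on (nsets V 2) (C ` {1..n})"
    and card_C: "\<And>i. i \<in> {1..n} \<Longrightarrow> card (C i) = i"
    and acyc: "\<And>i. i \<in> {1..n} \<Longrightarrow> acyclic_graph (C i)"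
    using assms(3) by (auto simp: beautiful_colouring_def nice_colouring_def edge_colouring_def)
  obtain V1 V2 where V12: "V1 \<union> V2 = V" "V1 \<inter> V2 = {}"
    and bip: "(\<Union>i\<in>{i \<in> {1..n}. i mod 2 = n mod 2}. C i) = {{u, v} | u v. u \<in> V1 \<and> v \<in> V2}"
    and halves: "\<forall>i\<in>{1..n}. i mod 2 = n mod 2 \<longrightarrow>
        card (\<Union>(C i) \<inter> V1) = card (\<Union>(C i)) div 2 \<and>
        card (\<Union>(C i) \<inter> V2) = (card (\<Union>(C i)) + 1) div 2"
    and sides: "\<forall>i\<in>{1..n}. i mod 2 \<noteq> n mod 2 \<longrightarrow>
        card (C i \<inter> nsets V1 2) = i div 2 \<and> card (C i \<inter> nsets V2 2) = (i + 1) div 2"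
    using assms(3) unfolding beautiful_colouring_def by (elim conjE exE) (rule that)
  have edges: "C i \<subseteq> nsets V 2" if "i \<in> {1..n}" for i
    using partition_onD1[OF part(2)] that by blast
  have disj: "i = j" if "i \<in> {1..n}" "j \<in> {1..n}" "e \<in> C i" "e \<in> C j" for i j e
  proof -
    have "C i = C j"
      using disjointD[OF partition_onD2[OF part(2)], of "C i" "C j"] that by blast
    then show ?thesis using part(1) that by (auto dest: inj_onD)
  qed
  have bip_edge: "\<exists>u\<in>V1. \<exists>v\<in>V2. e = {u, v}"
    if "i \<in> {1..n}" "i mod 2 = n mod 2" "e \<in> C i" for i e
  proof -
    have "e \<in> {{u, v} | u v. u \<in> V1 \<and> v \<in> V2}" using that unfolding bip[symmetric] by blast
    then show ?thesis by blast
  qed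
  let ?trees = "{T. spanning_tree V T \<and> heterochromatic n C T}"
  \<comment> \<open>The colours with a free choice. Colour 1 is left out: for even \<open>n\<close>
    its only edge lies inside \<open>V2\<close>.\<close>
  define P where "P = {i \<in> {2..n - 1}. i mod 2 = (n - 1) mod 2}"
  \<comment> \<open>This reads off from a tree the choice that it realises. Every subset of
    \<open>P\<close> occurs as a value, which bounds the number of trees from below.\<close>
  define side where "side T = {i \<in> P. \<exists>e\<in>T. e \<in> C i \<and> e \<subseteq> V1}" for T
  have "Pow P \<subseteq> side ` ?trees"
  proof
    fix S assume "S \<in> Pow P"
    then have S: "S \<subseteq> P" by simp
    then have "1 \<notin> S" by (auto simp: P_def)
    define A where "A i = (if i mod 2 = n mod 2 then C i else
        if i \<in> S then C i \<inter> nsets V1 2 else C i \<inter> nsets V2 2)" for i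
    have A_sub: "A i \<subseteq> C i" for i by (auto simp: A_def)
    have "\<exists>f. (\<forall>i\<in>{1..n}. f i \<in> A i) \<and> card {1..n} \<le> graph_rank V (f ` {1..n})"
    proof (rule rado_transversal[of "nsets V 2"])
      show "finite (nsets V 2)" using V(1) by (rule finite_imp_finite_nsets)
      show "A i \<subseteq> nsets V 2" if "i \<in> {1..n}" for i using A_sub edges[OF that] by blast
      show "card J \<le> graph_rank V (\<Union>i\<in>J. A i)" if "J \<subseteq> {1..n}" for J
        using V(1) V12 edges acyc card_C bip_edge halves[rule_format] sides[rule_format] \<open>1 \<notin> S\<close> that A_def
        by (rule card_le_graph_rank_chosen_sides)
    qed (use V(1) in \<open>auto intro: graph_rank_mono graph_rank_submodular\<close>)
    then obtain f where f: "\<And>i. i \<in> {1..n} \<Longrightarrow> f i \<in> A i" "n \<le> graph_rank V (f ` {1..n})"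
      by (metis card_atLeastAtMost diff_Suc_1)
    define T where "T = f ` {1..n}"
    have fC: "f i \<in> C i" if "i \<in> {1..n}" for i using f(1)[OF that] A_sub by blast
    \<comment> \<open>The classes are disjoint, so \<open>f i\<close> is the only edge of colour
      \<open>i\<close> in \<open>T\<close>. Both heterochromaticity and the value of
      \<open>side T\<close> rest on this.\<close>
    have T_C: "e = f i" if "e \<in> T" "i \<in> {1..n}" "e \<in> C i" for e i
    proof -
      from \<open>e \<in> T\<close> obtain j where j: "j \<in> {1..n}" "e = f j" by (auto simp: T_def)
      then have "i = j" using disj[of i j e] fC[of j] that by simp
      then show ?thesis using j by simp
    qed
    have T_edges: "T \<subseteq> nsets V 2" using fC edges unfolding T_def by blast
    have "card T \<le> n" unfolding T_def using card_image_le[of "{1..n}" f] by simp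
    \<comment> \<open>\<open>card T \<le> n \<le> graph_rank V T \<le> card T\<close>, so the chosen
      edges are distinct and independent.\<close>
    then have "card T = n" "graph_rank V T = n"
      using f(2) graph_rank_le_card[OF V(1) T_edges] by (auto simp: T_def)
    then have "spanning_tree V T" using V T_edges assms(2) by (intro spanning_tree_if_graph_rank) auto
    moreover have "heterochromatic n C T"
      unfolding heterochromatic_def using T_C by metis
    moreover have "side T = S"
    proof -
      have "i \<in> S \<longleftrightarrow> f i \<subseteq> V1" if "i \<in> P" for i
      proof -
        have i: "i \<in> {1..n}" "i mod 2 \<noteq> n mod 2"
          using that assms(1) by (cases n; auto simp: P_def mod2_eq_if split: if_splits)+
        show ?thesis
        proof (cases "i \<in> S")
          case True
          then show ?thesis using f(1)[OF i(1)] i(2) by (simp add: A_def nsets_def)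
        next
          case False
          then have "f i \<in> nsets V2 2" using f(1)[OF i(1)] i(2) by (simp add: A_def)
          \<comment> \<open>A nonempty set inside \<open>V2\<close> cannot lie inside
            \<open>V1\<close> as well.\<close>
          then have "f i \<subseteq> V2" "f i \<noteq> {}" by (auto simp: nsets_def)
          then show ?thesis using False V12(2) by blast
        qed
      qed
      moreover have "(\<exists>e\<in>T. e \<in> C i \<and> e \<subseteq> V1) \<longleftrightarrow> f i \<subseteq> V1" if "i \<in> P" for i
      proof -
        have "i \<in> {1..n}" using that by (auto simp: P_def)
        then have "f i \<in> T" "f i \<in> C i" using fC by (auto simp: T_def)
        then show ?thesis using T_C[OF _ \<open>i \<in> {1..n}\<close>] by blast
      qed
      ultimately show ?thesis using S by (auto simp: side_def)
    qed
    ultimately show "S \<in> side ` ?trees" by blast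
  qed
  moreover have "finite ?trees"
    by (rule finite_subset[of _ "Pow (nsets V 2)"])
      (auto simp: spanning_tree_def finite_imp_finite_nsets V(1))
  ultimately have "card (Pow P) \<le> card ?trees" by (rule surj_card_le[rotated])
  moreover have "card P = (n - 1) div 2"
    unfolding P_def card_same_parity by simp
  moreover have "finite P" by (simp add: P_def)
  ultimately show ?thesis by (simp add: card_Pow)
qed

end
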